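(* Let $0<p\le 1$ and let $\mathcal{X}\in\mathbb{C}^{I_1\times\cdots\times I_N}$ be a tensor with an independent Tucker decomposition $\mathcal{X}=[\![\mathcal{G};\mathbf{X}^{(1)},\ldots,\mathbf{X}^{(N)}]\!]$, where $\mathcal{G}\in\mathbb{C}^{J_1\times\cdots\times J_N}$ and $\mathbf{X}^{(n)}\in\mathbb{C}^{I_n\times J_n}$. Then $$\alpha\|\mathcal{G}\|_p\le\|\mathcal{X}\|_p\le\beta\|\mathcal{G}\|_p,$$ where $\beta=\|\mathbf{X}^{(1)}\|_2\|\mathbf{X}^{(2)}\|_2\cdots\|\mathbf{X}^{(N)}\|_2$ and $\alpha=\beta/\prod_{n=1}^N\kappa(\mathbf{X}^{(n)})$, with $\kappa(\mathbf{X}^{(n)})$ the condition number of the matrix $\mathbf{X}^{(n)}$.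
   Context: Mode-$n$ product: for $\mathcal{X}\in\mathbb{C}^{I_1\times\cdots\times I_N}$ and a matrix $\mathbf{A}\in\mathbb{C}^{J\times I_n}$, $[\mathcal{X}\times_n\mathbf{A}]_{i_1\cdots i_{n-1}ji_{n+1}\cdots i_N}=\sum_{i_n=1}^{I_n}x_{i_1\cdots i_N}a_{ji_n}$. Tucker decomposition: $\mathcal{X}=[\![\mathcal{G};\mathbf{X}^{(1)},\ldots,\mathbf{X}^{(N)}]\!]$ means $\mathcal{X}=\mathcal{G}\times_1\mathbf{X}^{(1)}\times_2\cdots\times_N\mathbf{X}^{(N)}$; it is independent if every factor matrix $\mathbf{X}^{(n)}$ has full column rank. Tensor $p$-quasi norm ($0<p\le1$) of $\mathcal{X}\in\mathbb{C}^{I_1\times\cdots\times I_N}$: $$\|\mathcal{X}\|_p=\inf\Big\{\Big(\sum_{s=1}^r|\lambda_s|^p\Big)^{1/p}:\ \mathcal{X}=\sum_{s=1}^r\lambda_s\,\mathbf{x}^{(1)}_s\circ\mathbf{x}^{(2)}_s\circ\cdots\circ\mathbf{x}^{(N)}_s,\ \|\mathbf{x}^{(n)}_s\|=1\ \forall s,n\Big\},$$ the infimum being over all $r$, scalars $\lambda_s$ and Euclidean unit vectors $\mathbf{x}^{(n)}_s\in\mathbb{C}^{I_n}$; $\circ$ is the outer product of vectors. For a matrix $\mathbf{A}$, $\|\mathbf{A}\|_2=\sigma_{\max}(\mathbf{A})$ is the spectral norm, and $\kappa(\mathbf{A})=\sigma_{\max}(\mathbf{A})/\sigma_{\min}(\mathbf{A})$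 (for a full-column-rank $I\times J$ matrix, there are $J$ singular values, all positive). *)

theory Defs
  imports
    "HOL-Library.FuncSet"
    "Jordan_Normal_Form.Schur_Decomposition"
    "Jordan_Normal_Form.DL_Rank"
begin

text \<open>
  A tensor of order \<open>N\<close> and shape \<open>d 0 \<times> \<dots> \<times> d (N - 1)\<close> is a function on multi-indices
  that is \<open>undefined\<close> outside its index set, so equality of tensors of one shape is plain equality.
  Modes and entries are numbered from 0.
\<close>

type_synonym tensor = "(nat \<Rightarrow> nat) \<Rightarrow> complex"

definition multi_indices :: "nat \<Rightarrow> (nat \<Rightarrow> nat) \<Rightarrow> (nat \<Rightarrow> nat) set" where
  "multi_indices N d = (\<Pi>\<^sub>E n\<in>{..<N}. {..<d n})"

definition tensors :: "nat \<Rightarrow> (nat \<Rightarrow> nat) \<Rightarrow> tensor set" where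
  "tensors N d = (multi_indices N d \<rightarrow>\<^sub>E UNIV)"

text \<open>The argument \<open>d\<close> is the shape of \<open>X\<close>; the result has shape \<open>d(n := dim_row A)\<close>.\<close>

definition mode_product :: "nat \<Rightarrow> (nat \<Rightarrow> nat) \<Rightarrow> tensor \<Rightarrow> nat \<Rightarrow> complex mat \<Rightarrow> tensor" where
  "mode_product N d X n A =
     (\<lambda>i \<in> multi_indices N (d(n := dim_row A)). \<Sum>k<d n. X (i(n := k)) * A $$ (i n, k))"

text \<open>
  \<open>tucker_upto N d G F m\<close> is \<open>G\<close>, of shape \<open>d\<close>, multiplied successively by \<open>F 0, \<dots>, F (m - 1)\<close>
  in the modes \<open>0, \<dots>, m - 1\<close>; the first \<open>m\<close> dimensions of the shape have then been replaced.
\<close>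

fun tucker_upto :: "nat \<Rightarrow> (nat \<Rightarrow> nat) \<Rightarrow> tensor \<Rightarrow> (nat \<Rightarrow> complex mat) \<Rightarrow> nat \<Rightarrow> tensor" where
  "tucker_upto N d G F 0 = G"
| "tucker_upto N d G F (Suc m) =
     mode_product N (\<lambda>n. if n < m then dim_row (F n) else d n) (tucker_upto N d G F m) m (F m)"

definition tucker :: "nat \<Rightarrow> (nat \<Rightarrow> nat) \<Rightarrow> tensor \<Rightarrow> (nat \<Rightarrow> complex mat) \<Rightarrow> tensor" where
  "tucker N d G F = tucker_upto N d G F N"

definition full_column_rank :: "complex mat \<Rightarrow> bool" where
  "full_column_rank A \<longleftrightarrow> vec_space.rank (dim_row A) A = dim_col A"

definition independent_tucker ::
  "nat \<Rightarrow> (nat \<Rightarrow> nat) \<Rightarrow> (nat \<Rightarrow> nat) \<Rightarrow> tensor \<Rightarrow> tensor \<Rightarrow> (nat \<Rightarrow> complex mat) \<Rightarrow> bool" where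
  "independent_tucker N I J X G F \<longleftrightarrow>
     X \<in> tensors N I \<and> G \<in> tensors N J \<and>
     (\<forall>n<N. F n \<in> carrier_mat (I n) (J n)) \<and>
     X = tucker N J G F \<and>
     (\<forall>n<N. full_column_rank (F n))"

definition euclidean_norm :: "complex vec \<Rightarrow> real" where
  "euclidean_norm v = sqrt (\<Sum>i<dim_vec v. (cmod (v $ i))\<^sup>2)"

definition outer_product :: "nat \<Rightarrow> (nat \<Rightarrow> nat) \<Rightarrow> (nat \<Rightarrow> complex vec) \<Rightarrow> tensor" where
  "outer_product N d x = (\<lambda>i \<in> multi_indices N d. \<Prod>n<N. x n $ i n)"

definition unit_decomposition ::
  "nat \<Rightarrow> (nat \<Rightarrow> nat) \<Rightarrow> tensor \<Rightarrow> nat \<Rightarrow> (nat \<Rightarrow> complex) \<Rightarrow> (nat \<Rightarrow> nat \<Rightarrow> complex vec) \<Rightarrow> bool"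
where
  "unit_decomposition N d X r c x \<longleftrightarrow>
     (\<forall>s<r. \<forall>n<N. x s n \<in> carrier_vec (d n) \<and> euclidean_norm (x s n) = 1) \<and>
     X = (\<lambda>i \<in> multi_indices N d. \<Sum>s<r. c s * outer_product N d (x s) i)"

text \<open>
  The set below is bounded below by 0, and nonempty for every \<open>X \<in> tensors N d\<close> (expand \<open>X\<close> in
  outer products of standard basis vectors), so the real \<open>Inf\<close> is the true infimum.
\<close>

definition tensor_quasi_norm :: "nat \<Rightarrow> (nat \<Rightarrow> nat) \<Rightarrow> real \<Rightarrow> tensor \<Rightarrow> real" where
  "tensor_quasi_norm N d p X =
     Inf {(\<Sum>s<r. cmod (c s) powr p) powr (1 / p) | r c x. unit_decomposition N d X r c x}"

text \<open>
  As a set, without multiplicities. For a matrix with at least as many rows as columns, in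
  particular for one of full column rank, these are the usual \<open>dim_col A\<close> singular values.
  (A matrix with more columns than rows gets the additional value 0.)
\<close>

definition singular_values :: "complex mat \<Rightarrow> real set" where
  "singular_values A =
     {\<sigma>. 0 \<le> \<sigma> \<and> eigenvalue (mat_adjoint A * A) (complex_of_real (\<sigma>\<^sup>2))}"

definition sigma_max :: "complex mat \<Rightarrow> real" where
  "sigma_max A = Max (singular_values A)"

definition sigma_min :: "complex mat \<Rightarrow> real" where
  "sigma_min A = Min (singular_values A)"

definition spectral_norm :: "complex mat \<Rightarrow> real" where
  "spectral_norm A = sigma_max A"

definition condition_number :: "complex mat \<Rightarrow> real" where
  "condition_number A = sigma_max A / sigma_min A"

end

theory Submission
  imports Defs
begin

text \<open>
  Multiplying the vectors of a rank-one decomposition of \<open>G\<close> by the matrices \<open>F n\<close> and renormalising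
  gives a decomposition of \<open>X\<close> whose coefficients have grown by at most the product of the operator
  norms of the \<open>F n\<close>. The upper bound is this remark for the \<open>F n\<close> themselves, and the lower bound is
  the same remark for their Moore-Penrose inverses, which map \<open>X\<close> back to \<open>G\<close> and have norm at most
  \<open>1 / sigma_min (F n)\<close>. Since \<open>sigma_max / condition_number = sigma_min\<close>, this gives \<open>\<alpha>\<close>.
\<close>

text \<open>The vectors in a decomposition of \<open>X\<close> need not lie in the ranges of the
  \<open>F n\<close>, so a lower estimate for the lengths of the vectors
  \<open>F n *\<^sub>v v\<close> is not enough for the lower bound: left inverses controlled on the
  whole space are required. The Moore-Penrose inverse qualifies because it first projects
  orthogonally onto the range, which does not lengthen vectors. The singular values are defined
  through eigenvalues of the Gram matrix, so operator norm estimates require that the extreme values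
  of its quadratic form be eigenvalues. This is derived from a supremum and a coercivity estimate,
  with no compactness argument. On the tensor side, the successive mode products are resummed into a
  single sum over multi-indices whose weights factor over the modes. The action on outer products
  and the cancellation of a left inverse then split into independent one-mode sums.\<close>

section \<open>Adjoint matrices and the Euclidean norm\<close>

lemma mat_adjoint_carrier [simp]:
  "A \<in> carrier_mat m n \<Longrightarrow> mat_adjoint A \<in> carrier_mat n m"
  unfolding mat_adjoint_def by auto

lemma dim_mat_adjoint [simp]:
  "dim_row (mat_adjoint A) = dim_col A" "dim_col (mat_adjoint A) = dim_row A"
  unfolding mat_adjoint_def by auto

lemma index_mat_adjoint:
  assumes "i < dim_col A" "j < dim_row A"
  shows "mat_adjoint A $$ (i, j) = conjugate (A $$ (j, i))"
  using assms unfolding mat_adjoint_def by (simp add: mat_of_rows_index)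

lemma cscalar_prod_mult_mat_vec:
  fixes A :: "complex mat"
  assumes A: "A \<in> carrier_mat m n" and x: "x \<in> carrier_vec n" and y: "y \<in> carrier_vec m"
  shows "(A *\<^sub>v x) \<bullet>c y = x \<bullet>c (mat_adjoint A *\<^sub>v y)"
proof -
  have "(A *\<^sub>v x) \<bullet>c y = (\<Sum>i<m. \<Sum>j<n. A $$ (i, j) * x $ j * cnj (y $ i))"
    using A x y by (simp add: scalar_prod_def sum_distrib_right atLeast0LessThan)
  also have "\<dots> = (\<Sum>j<n. \<Sum>i<m. A $$ (i, j) * x $ j * cnj (y $ i))"
    by (rule sum.swap)
  also have "\<dots> = x \<bullet>c (mat_adjoint A *\<^sub>v y)"
    using A x y
    by (simp add: scalar_prod_def sum_distrib_left atLeast0LessThan index_mat_adjoint mult_ac)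
  finally show ?thesis .
qed

lemma euclidean_norm_nonneg [simp]: "0 \<le> euclidean_norm v"
  by (simp add: euclidean_norm_def sum_nonneg)

lemma euclidean_norm_sq: "(euclidean_norm v)\<^sup>2 = (\<Sum>i<dim_vec v. (cmod (v $ i))\<^sup>2)"
  by (simp add: euclidean_norm_def sum_nonneg)

lemma cscalar_prod_self: "v \<bullet>c v = complex_of_real ((euclidean_norm v)\<^sup>2)"
  by (simp add: euclidean_norm_sq scalar_prod_def complex_norm_square atLeast0LessThan
      flip: of_real_power)

lemma euclidean_norm_eq_0_iff:
  assumes "v \<in> carrier_vec n"
  shows "euclidean_norm v = 0 \<longleftrightarrow> v = 0\<^sub>v n"
  using conjugate_square_eq_0_vec[OF assms] by (simp add: cscalar_prod_self)

lemma euclidean_norm_smult: "euclidean_norm (a \<cdot>\<^sub>v v) = cmod a * euclidean_norm v"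
  by (simp add: euclidean_norm_def norm_mult power_mult_distrib real_sqrt_mult flip: sum_distrib_left)

lemma euclidean_norm_unit_vec: "i < n \<Longrightarrow> euclidean_norm (unit_vec n i) = 1"
  by (simp add: euclidean_norm_def unit_vec_def if_distrib[of "\<lambda>z. (cmod z)\<^sup>2"] cong: if_cong)

lemma cmod_vec_index_le:
  assumes "i < dim_vec v" shows "cmod (v $ i) \<le> euclidean_norm v"
  using assms unfolding euclidean_norm_def
  by (intro real_le_rsqrt member_le_sum) auto

section \<open>Quadratic forms and extreme eigenvalues of Hermitian matrices\<close>

lemma quadratic_form_bounded:
  fixes K :: "complex mat"
  assumes K: "K \<in> carrier_mat n n"
  obtains C where "0 < C"
    and "\<And>x. x \<in> carrier_vec n \<Longrightarrow> Re (x \<bullet>c (K *\<^sub>v x)) \<le> C * (euclidean_norm x)\<^sup>2"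
proof
  \<comment> \<open>The summand 1 keeps \<open>C\<close> positive even for \<open>K = 0\<close>;
    later arguments divide by such constants.\<close>
  define C where "C = 1 + (\<Sum>i<n. \<Sum>j<n. cmod (K $$ (i, j)))"
  show "0 < C" unfolding C_def by (intro add_pos_nonneg sum_nonneg) auto
  fix x :: "complex vec" assume x: "x \<in> carrier_vec n"
  have "x \<bullet>c (K *\<^sub>v x) = (\<Sum>i<n. \<Sum>j<n. x $ i * cnj (K $$ (i, j) * x $ j))"
    using K x by (simp add: scalar_prod_def sum_distrib_left atLeast0LessThan)
  then have "Re (x \<bullet>c (K *\<^sub>v x)) \<le> cmod (\<Sum>i<n. \<Sum>j<n. x $ i * cnj (K $$ (i, j) * x $ j))"
    by (simp only: complex_Re_le_cmod)
  also have "\<dots> \<le> (\<Sum>i<n. \<Sum>j<n. cmod (x $ i * cnj (K $$ (i, j) * x $ j)))"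
    by (intro sum_norm_le order.trans[OF norm_sum] order.refl)
  also have "\<dots> \<le> (\<Sum>i<n. \<Sum>j<n. cmod (K $$ (i, j)) * (euclidean_norm x)\<^sup>2)"
  proof (intro sum_mono)
    fix i j assume ij: "i \<in> {..<n}" "j \<in> {..<n}"
    have "cmod (x $ i) * cmod (x $ j) \<le> euclidean_norm x * euclidean_norm x"
      using ij x by (intro mult_mono cmod_vec_index_le) auto
    then show "cmod (x $ i * cnj (K $$ (i, j) * x $ j)) \<le> cmod (K $$ (i, j)) * (euclidean_norm x)\<^sup>2"
      by (simp add: norm_mult power2_eq_square mult.left_commute[of _ "cmod (K $$ (i, j))"]
          mult_left_mono)
  qed
  also have "\<dots> \<le> C * (euclidean_norm x)\<^sup>2"
    by (simp add: C_def distrib_right sum_distrib_right)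
  finally show "Re (x \<bullet>c (K *\<^sub>v x)) \<le> C * (euclidean_norm x)\<^sup>2" .
qed

lemma euclidean_norm_sq_diff:
  assumes x: "x \<in> carrier_vec n" and y: "y \<in> carrier_vec n"
  shows "(euclidean_norm (x - y))\<^sup>2
       = (euclidean_norm x)\<^sup>2 - 2 * Re (x \<bullet>c y) + (euclidean_norm y)\<^sup>2"
proof -
  have "(cmod (a - b))\<^sup>2 = (cmod a)\<^sup>2 - 2 * Re (a * cnj b) + (cmod b)\<^sup>2" for a b
    by (simp add: cmod_power2) (simp add: power2_eq_square algebra_simps)
  then show ?thesis
    using x y by (simp add: euclidean_norm_sq scalar_prod_def atLeast0LessThan sum.distrib
        sum_subtractf sum_distrib_left)
qed

text \<open>Hermitian symmetry gives the two mixed terms equal real parts, so they merge. The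
  coercivity proof uses this with \<open>y = K *\<^sub>v x\<close> and
  \<open>t = 1 / C\<close>.\<close>

lemma quadratic_form_minus_smult:
  fixes K :: "complex mat"
  assumes K: "K \<in> carrier_mat n n" and hermitian: "mat_adjoint K = K"
    and x: "x \<in> carrier_vec n" and y: "y \<in> carrier_vec n"
  shows "Re ((x - complex_of_real t \<cdot>\<^sub>v y) \<bullet>c (K *\<^sub>v (x - complex_of_real t \<cdot>\<^sub>v y)))
       = Re (x \<bullet>c (K *\<^sub>v x)) - 2 * t * Re (y \<bullet>c (K *\<^sub>v x)) + t\<^sup>2 * Re (y \<bullet>c (K *\<^sub>v y))"
proof -
  let ?Q = "\<lambda>a b. a \<bullet>c (K *\<^sub>v b)"
  have "?Q x y = (K *\<^sub>v x) \<bullet>c y"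
    using cscalar_prod_mult_mat_vec[OF K x y] hermitian by simp
  also have "\<dots> = cnj (?Q y x)"
    using conjugate_conjugate_sprod[of "K *\<^sub>v x" n y] conjugate_vec_sprod_comm[of "K *\<^sub>v x" n y]
      conjugate_sprod_vec[of y n "conjugate (K *\<^sub>v x)"] comm_scalar_prod[of "K *\<^sub>v x" n "conjugate y"] K x y
    by simp
  finally have sym: "Re (?Q x y) = Re (?Q y x)"
    by simp
  have Kd: "K *\<^sub>v (x - complex_of_real t \<cdot>\<^sub>v y) = K *\<^sub>v x - complex_of_real t \<cdot>\<^sub>v (K *\<^sub>v y)"
    using K x y by (simp add: mult_minus_distrib_mat_vec mult_mat_vec)
  have "?Q (x - complex_of_real t \<cdot>\<^sub>v y) (x - complex_of_real t \<cdot>\<^sub>v y)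
      = ?Q x x - complex_of_real t * ?Q y x - complex_of_real t * ?Q x y
        + complex_of_real t * complex_of_real t * ?Q y y"
    unfolding Kd using K x y
    by (simp add: scalar_prod_def sum_subtractf sum.distrib sum_distrib_left algebra_simps)
  then show ?thesis
    using sym by (simp add: power2_eq_square)
qed

text \<open>Nonnegativity of the form at a shifted vector bounds the squared norm of
  \<open>K *\<^sub>v x\<close> by \<open>C\<close> times the form at \<open>x\<close>. Invertibility
  bounds the squared norm of \<open>x\<close> by \<open>D\<close> times that of
  \<open>K *\<^sub>v x\<close>. Chaining the two gives the constant
  \<open>1 / (C * D)\<close>.\<close>

lemma hermitian_invertible_nonneg_imp_coercive:
  fixes K :: "complex mat"
  assumes K: "K \<in> carrier_mat n n" and hermitian: "mat_adjoint K = K"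
    and nonneg: "\<And>x. x \<in> carrier_vec n \<Longrightarrow> 0 \<le> Re (x \<bullet>c (K *\<^sub>v x))"
    and det: "det K \<noteq> 0"
  obtains c where "0 < c"
    and "\<And>x. x \<in> carrier_vec n \<Longrightarrow> c * (euclidean_norm x)\<^sup>2 \<le> Re (x \<bullet>c (K *\<^sub>v x))"
proof -
  obtain C where C: "0 < C"
    and C_bound: "\<And>x. x \<in> carrier_vec n \<Longrightarrow> Re (x \<bullet>c (K *\<^sub>v x)) \<le> C * (euclidean_norm x)\<^sup>2"
    using quadratic_form_bounded[OF K] by blast
  obtain L where L: "L \<in> carrier_mat n n" and LK: "L * K = 1\<^sub>m n"
    using det_non_zero_imp_unit[OF K det] K unfolding Units_def by (auto simp: ring_mat_def)
  \<comment> \<open>The form of \<open>mat_adjoint L * L\<close> at a vector is the squared norm of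
    its image under \<open>L\<close>, so \<open>D\<close> bounds the squared operator norm of the
    inverse of \<open>K\<close>.\<close>
  obtain D where D: "0 < D"
    and D_bound: "\<And>x. x \<in> carrier_vec n \<Longrightarrow>
      Re (x \<bullet>c ((mat_adjoint L * L) *\<^sub>v x)) \<le> D * (euclidean_norm x)\<^sup>2"
    using quadratic_form_bounded[OF mult_carrier_mat[OF mat_adjoint_carrier[OF L] L]] by blast
  have "1 / (C * D) * (euclidean_norm x)\<^sup>2 \<le> Re (x \<bullet>c (K *\<^sub>v x))" if x: "x \<in> carrier_vec n" for x
  proof -
    define y where "y = K *\<^sub>v x"
    have y: "y \<in> carrier_vec n" using K x by (simp add: y_def)
    have Ly: "L *\<^sub>v y = x"
      using K L LK x by (simp add: y_def flip: assoc_mult_mat_vec)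
    have "(L *\<^sub>v y) \<bullet>c (L *\<^sub>v y) = y \<bullet>c ((mat_adjoint L * L) *\<^sub>v y)"
      using cscalar_prod_mult_mat_vec[OF L y, of "L *\<^sub>v y"] L y
      by (simp add: assoc_mult_mat_vec[OF mat_adjoint_carrier[OF L] L y])
    then have "(euclidean_norm x)\<^sup>2 \<le> D * (euclidean_norm y)\<^sup>2"
      using D_bound[OF y] by (metis Ly cscalar_prod_self Re_complex_of_real)
    moreover \<comment> \<open>evaluate the form at \<open>x - (1 / C) K x\<close>\<close>
    have "(euclidean_norm y)\<^sup>2 \<le> C * Re (x \<bullet>c (K *\<^sub>v x))"
    proof -
      have "0 \<le> Re (x \<bullet>c (K *\<^sub>v x)) - 2 * (1 / C) * (euclidean_norm y)\<^sup>2
              + (1 / C)\<^sup>2 * Re (y \<bullet>c (K *\<^sub>v y))"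
        using nonneg[of "x - complex_of_real (1 / C) \<cdot>\<^sub>v y"] x y
        unfolding quadratic_form_minus_smult[OF K hermitian x y]
        by (simp flip: y_def add: cscalar_prod_self)
      \<comment> \<open>The last term is at most \<open>1 / C\<close> times the squared norm of
        \<open>y\<close>, so the two \<open>y\<close> terms together contribute at most
        \<open>- 1 / C\<close> times it; multiplying by \<open>C\<close> gives the claim.\<close>
      also have "\<dots> \<le> Re (x \<bullet>c (K *\<^sub>v x)) - 2 * (1 / C) * (euclidean_norm y)\<^sup>2
              + (1 / C)\<^sup>2 * (C * (euclidean_norm y)\<^sup>2)"
        using C_bound[OF y] by (intro add_left_mono mult_left_mono) auto
      finally show ?thesis using C by (simp add: field_simps power2_eq_square)
    qed
    ultimately have "(euclidean_norm x)\<^sup>2 \<le> D * (C * Re (x \<bullet>c (K *\<^sub>v x)))"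
      using D by (meson mult_left_mono order.trans less_imp_le)
    then show ?thesis using C D by (simp add: field_simps)
  qed
  then show thesis using that[of "1 / (C * D)"] C D by simp
qed

lemma mat_adjoint_eqI:
  assumes "H \<in> carrier_mat n n"
    and "\<And>i j. i < n \<Longrightarrow> j < n \<Longrightarrow> H $$ (i, j) = conjugate (H $$ (j, i))"
  shows "mat_adjoint H = H"
proof (rule eq_matI)
  fix i j assume "i < dim_row H" "j < dim_col H"
  then have "i < n" "j < n" using assms(1) by auto
  then show "mat_adjoint H $$ (i, j) = H $$ (i, j)"
    using assms(1) by (subst assms(2)) (simp_all add: index_mat_adjoint)
qed (use assms(1) in auto)

text \<open>
  The supremum \<open>M\<close> of the Rayleigh quotient is an eigenvalue: otherwise \<open>M - H\<close> is invertible,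
  hence coercive, and \<open>M\<close> could be lowered.
\<close>

lemma hermitian_max_eigenvalue:
  fixes H :: "complex mat"
  assumes H: "H \<in> carrier_mat n n" and hermitian: "mat_adjoint H = H" and n: "0 < n"
  obtains M where "eigenvalue H (complex_of_real M)"
    and "\<And>x. x \<in> carrier_vec n \<Longrightarrow> Re (x \<bullet>c (H *\<^sub>v x)) \<le> M * (euclidean_norm x)\<^sup>2"
proof -
  let ?Q = "\<lambda>x. Re (x \<bullet>c (H *\<^sub>v x))"
  define R where "R = ?Q ` {x \<in> carrier_vec n. euclidean_norm x = 1}"
  define M where "M = Sup R"
  define K where "K = complex_of_real M \<cdot>\<^sub>m 1\<^sub>m n - H"
  have K: "K \<in> carrier_mat n n" unfolding K_def using H by (rule minus_carrier_mat)
  have Kx: "K *\<^sub>v x = complex_of_real M \<cdot>\<^sub>v x - H *\<^sub>v x" if "x \<in> carrier_vec n" for x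
  proof (rule eq_vecI)
    fix i assume "i < dim_vec (complex_of_real M \<cdot>\<^sub>v x - H *\<^sub>v x)"
    then have i: "i < n" using H by simp
    have "(K *\<^sub>v x) $ i = (\<Sum>j<n. complex_of_real M * (if j = i then x $ j else 0) - H $$ (i, j) * x $ j)"
      using i H that unfolding K_def
      by (auto simp: scalar_prod_def atLeast0LessThan algebra_simps intro!: sum.cong)
    also have "\<dots> = complex_of_real M * x $ i - (\<Sum>j<n. H $$ (i, j) * x $ j)"
      using i by (simp add: sum_subtractf flip: sum_distrib_left)
    finally show "(K *\<^sub>v x) $ i = (complex_of_real M \<cdot>\<^sub>v x - H *\<^sub>v x) $ i"
      using i H that by (simp add: scalar_prod_def atLeast0LessThan)
  qed (use K H in auto)
  have QK: "Re (x \<bullet>c (K *\<^sub>v x)) = M * (euclidean_norm x)\<^sup>2 - ?Q x" if x: "x \<in> carrier_vec n" for x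
  proof -
    have "x \<bullet>c (K *\<^sub>v x) = complex_of_real M * (x \<bullet>c x) - x \<bullet>c (H *\<^sub>v x)"
      unfolding Kx[OF x] using H x
      by (simp add: scalar_prod_def sum_subtractf sum_distrib_left algebra_simps)
    then show ?thesis by (simp add: cscalar_prod_self flip: of_real_power)
  qed
  have hermitian_K: "mat_adjoint K = K"
  proof (rule mat_adjoint_eqI[OF K])
    fix i j assume ij: "i < n" "j < n"
    have "H $$ (i, j) = conjugate (H $$ (j, i))"
      using index_mat_adjoint[of i H j] hermitian H ij by simp
    then show "K $$ (i, j) = conjugate (K $$ (j, i))"
      using H ij by (simp add: K_def)
  qed
  \<comment> \<open>The real \<open>Sup\<close> is meaningful only for a nonempty set that is
    bounded above; \<open>0 < n\<close> supplies a unit vector.\<close>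
  have R_ne: "R \<noteq> {}"
    unfolding R_def using euclidean_norm_unit_vec[OF n] unit_vec_carrier by blast
  have bdd: "bdd_above R"
  proof -
    obtain C where "\<And>x. x \<in> carrier_vec n \<Longrightarrow> ?Q x \<le> C * (euclidean_norm x)\<^sup>2"
      using quadratic_form_bounded[OF H] by blast
    then show ?thesis unfolding R_def by (intro bdd_aboveI[of _ C]) fastforce
  qed
  have Q_le: "?Q x \<le> M * (euclidean_norm x)\<^sup>2" if x: "x \<in> carrier_vec n" for x
  proof (cases "euclidean_norm x = 0")
    case True
    then have "x = 0\<^sub>v n" using euclidean_norm_eq_0_iff[OF x] by simp
    then show ?thesis using True H by simp
  next
    case False
    define a where "a = euclidean_norm x"
    define u where "u = complex_of_real (1 / a) \<cdot>\<^sub>v x"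
    have u: "u \<in> carrier_vec n" "euclidean_norm u = 1"
      using False x by (auto simp: u_def a_def euclidean_norm_smult norm_divide)
    have "?Q u = (1 / a)\<^sup>2 * ?Q x"
      using x H by (simp add: u_def mult_mat_vec conjugate_smult_vec power2_eq_square
          del: of_real_divide)
    moreover have "?Q u \<le> M"
      unfolding M_def R_def by (rule cSup_upper) (use u bdd in \<open>auto simp: R_def\<close>)
    ultimately show ?thesis
      using False by (simp add: a_def field_simps) (metis mult.commute mult_left_mono zero_le_power2)
  qed
  have "det K = 0"
  proof (rule ccontr)
    assume "det K \<noteq> 0"
    moreover have "0 \<le> Re (x \<bullet>c (K *\<^sub>v x))" if "x \<in> carrier_vec n" for x
      using QK[OF that] Q_le[OF that] by simp
    ultimately obtain c where c: "0 < c"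
      and "\<And>x. x \<in> carrier_vec n \<Longrightarrow> c * (euclidean_norm x)\<^sup>2 \<le> Re (x \<bullet>c (K *\<^sub>v x))"
      using hermitian_invertible_nonneg_imp_coercive[OF K hermitian_K] by blast
    then have "?Q x \<le> M - c" if "x \<in> carrier_vec n" "euclidean_norm x = 1" for x
      using QK[OF that(1)] that by fastforce
    then have "M \<le> M - c"
      unfolding M_def[unfolded R_def] using R_ne
      by (intro cSup_least) (auto simp: R_def M_def)
    then show False using c by simp
  qed
  then obtain v where v: "v \<in> carrier_vec n" "v \<noteq> 0\<^sub>v n" "K *\<^sub>v v = 0\<^sub>v n"
    using det_0_iff_vec_prod_zero_field[OF K] by blast
  have "H *\<^sub>v v = complex_of_real M \<cdot>\<^sub>v v"
  proof (rule eq_vecI)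
    fix i assume "i < dim_vec (complex_of_real M \<cdot>\<^sub>v v)"
    then have i: "i < n" using v by simp
    have "(complex_of_real M \<cdot>\<^sub>v v - H *\<^sub>v v) $ i = 0"
      using v(3) Kx[OF v(1)] i by simp
    then show "(H *\<^sub>v v) $ i = (complex_of_real M \<cdot>\<^sub>v v) $ i"
      using i v(1) H by simp
  qed (use H v in auto)
  then have "eigenvalue H (complex_of_real M)"
    using v H unfolding eigenvalue_def eigenvector_def by auto
  then show thesis using that Q_le by blast
qed

text \<open>Negating the matrix exchanges the two ends of the spectrum, so the witness is minus the
  maximal eigenvalue of \<open>- H\<close>.\<close>

lemma hermitian_min_eigenvalue:
  fixes H :: "complex mat"
  assumes H: "H \<in> carrier_mat n n" and hermitian: "mat_adjoint H = H" and n: "0 < n"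
  obtains M where "eigenvalue H (complex_of_real M)"
    and "\<And>x. x \<in> carrier_vec n \<Longrightarrow> M * (euclidean_norm x)\<^sup>2 \<le> Re (x \<bullet>c (H *\<^sub>v x))"
proof -
  have mH: "- H \<in> carrier_mat n n" using H by simp
  have neg: "(- H) *\<^sub>v x = - (H *\<^sub>v x)" if "x \<in> carrier_vec n" for x
    using H that by (intro eq_vecI) (auto simp: scalar_prod_def sum_negf)
  have "mat_adjoint (- H) = - H"
  proof (rule mat_adjoint_eqI[OF mH])
    fix i j assume ij: "i < n" "j < n"
    show "(- H) $$ (i, j) = conjugate ((- H) $$ (j, i))"
      using index_mat_adjoint[of i H j] hermitian H ij by simp
  qed
  then obtain M where M: "eigenvalue (- H) (complex_of_real M)"
    and M_bound: "\<And>x. x \<in> carrier_vec n \<Longrightarrow> Re (x \<bullet>c ((- H) *\<^sub>v x)) \<le> M * (euclidean_norm x)\<^sup>2"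
    using hermitian_max_eigenvalue[OF mH _ n] by blast
  obtain v where v: "v \<in> carrier_vec n" "v \<noteq> 0\<^sub>v n" "- (H *\<^sub>v v) = complex_of_real M \<cdot>\<^sub>v v"
    using M H neg unfolding eigenvalue_def eigenvector_def by auto
  have "H *\<^sub>v v = - (complex_of_real M \<cdot>\<^sub>v v)"
    using v(3) by (metis uminus_uminus_vec)
  then have "H *\<^sub>v v = complex_of_real (- M) \<cdot>\<^sub>v v"
    by auto
  then have "eigenvalue H (complex_of_real (- M))"
    using v H unfolding eigenvalue_def eigenvector_def by auto
  moreover have "- M * (euclidean_norm x)\<^sup>2 \<le> Re (x \<bullet>c (H *\<^sub>v x))" if x: "x \<in> carrier_vec n" for x
  proof -
    have "x \<bullet>c ((- H) *\<^sub>v x) = - (x \<bullet>c (H *\<^sub>v x))"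
      unfolding neg[OF x] using x H by (simp add: scalar_prod_def sum_negf)
    then show ?thesis using M_bound[OF x] by simp
  qed
  ultimately show thesis using that by blast
qed

section \<open>Gram matrices and singular values\<close>

lemma hermitian_gram:
  fixes A :: "complex mat"
  assumes A: "A \<in> carrier_mat m n"
  shows "mat_adjoint (mat_adjoint A * A) = mat_adjoint A * A"
proof (rule mat_adjoint_eqI[of _ n])
  fix i j assume "i < n" "j < n"
  then show "(mat_adjoint A * A) $$ (i, j) = conjugate ((mat_adjoint A * A) $$ (j, i))"
    using A by (simp add: scalar_prod_def index_mat_adjoint mult.commute)
qed (use mult_carrier_mat[OF mat_adjoint_carrier[OF A] A] in simp)

text \<open>The link from spectral estimates to lengths: a bound on the form of the Gram matrix is a
  bound on the squared norm of \<open>A *\<^sub>v x\<close>.\<close>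

lemma quadratic_form_gram:
  fixes A :: "complex mat"
  assumes A: "A \<in> carrier_mat m n" and x: "x \<in> carrier_vec n"
  shows "x \<bullet>c ((mat_adjoint A * A) *\<^sub>v x) = complex_of_real ((euclidean_norm (A *\<^sub>v x))\<^sup>2)"
  using cscalar_prod_mult_mat_vec[OF A x, of "A *\<^sub>v x"] A x
  by (simp add: assoc_mult_mat_vec[OF mat_adjoint_carrier[OF A] A x] cscalar_prod_self)

lemma finite_eigenvalues:
  fixes A :: "'a :: field mat"
  assumes A: "A \<in> carrier_mat n n"
  shows "finite {k. eigenvalue A k}"
  unfolding eigenvalue_root_char_poly[OF A]
  by (rule poly_roots_finite) (use degree_monic_char_poly[OF A] in auto)

text \<open>Together with \<open>singular_values_nonempty\<close>, this makes the \<open>Max\<close>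
  and \<open>Min\<close> in \<open>sigma_max\<close> and \<open>sigma_min\<close> genuine
  extrema.\<close>

lemma finite_singular_values:
  assumes A: "A \<in> carrier_mat m n"
  shows "finite (singular_values A)"
proof (rule finite_subset)
  let ?E = "{k. eigenvalue (mat_adjoint A * A) k}"
  show "singular_values A \<subseteq> (\<lambda>k. sqrt (Re k)) ` ?E"
  proof
    fix s assume s: "s \<in> singular_values A"
    then have "s = sqrt (Re (complex_of_real (s\<^sup>2)))"
      by (simp add: singular_values_def)
    then show "s \<in> (\<lambda>k. sqrt (Re k)) ` ?E"
      using s unfolding singular_values_def by blast
  qed
  show "finite ((\<lambda>k. sqrt (Re k)) ` ?E)"
    using finite_eigenvalues[OF mult_carrier_mat[OF mat_adjoint_carrier[OF A] A]] by simp
qed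

text \<open>Pairing the eigenvector equation with the eigenvector \<open>v\<close> shows that the
  squared norm of \<open>A *\<^sub>v v\<close> is \<open>M\<close> times that of \<open>v\<close>.
  Hence \<open>M\<close> cannot be negative, and \<open>M = 0\<close> would put \<open>v\<close>
  into the kernel of \<open>A\<close>.\<close>

lemma eigenvalue_gram_nonneg:
  assumes A: "A \<in> carrier_mat m n" and M: "eigenvalue (mat_adjoint A * A) (complex_of_real M)"
  shows "0 \<le> M"
    and "(\<And>x. x \<in> carrier_vec n \<Longrightarrow> A *\<^sub>v x = 0\<^sub>v m \<Longrightarrow> x = 0\<^sub>v n) \<Longrightarrow> 0 < M"
proof -
  obtain v where v: "v \<in> carrier_vec n" "v \<noteq> 0\<^sub>v n"
    "(mat_adjoint A * A) *\<^sub>v v = complex_of_real M \<cdot>\<^sub>v v"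
    using A M unfolding eigenvalue_def eigenvector_def by auto
  have "complex_of_real ((euclidean_norm (A *\<^sub>v v))\<^sup>2) = complex_of_real M * (v \<bullet>c v)"
    using quadratic_form_gram[OF A v(1)] v by (simp add: conjugate_smult_vec)
  then have eq: "(euclidean_norm (A *\<^sub>v v))\<^sup>2 = M * (euclidean_norm v)\<^sup>2"
    by (simp only: cscalar_prod_self of_real_eq_iff flip: of_real_mult)
  have pos: "0 < (euclidean_norm v)\<^sup>2"
    using euclidean_norm_eq_0_iff[OF v(1)] v(2) by simp
  show nonneg: "0 \<le> M"
    using eq pos by (metis zero_le_mult_iff zero_le_power2 not_less)
  assume inj: "\<And>x. x \<in> carrier_vec n \<Longrightarrow> A *\<^sub>v x = 0\<^sub>v m \<Longrightarrow> x = 0\<^sub>v n"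
  have "M \<noteq> 0"
  proof
    assume "M = 0"
    then have "euclidean_norm (A *\<^sub>v v) = 0" using eq by simp
    then show False
      using inj[OF v(1)] v(1,2) A euclidean_norm_eq_0_iff[of "A *\<^sub>v v" m] by simp
  qed
  then show "0 < M" using nonneg by simp
qed

lemma sqrt_in_singular_values:
  assumes A: "A \<in> carrier_mat m n" and M: "eigenvalue (mat_adjoint A * A) (complex_of_real M)"
  shows "sqrt M \<in> singular_values A"
proof -
  have "0 \<le> M" by (rule eigenvalue_gram_nonneg(1)[OF A M])
  then have "0 \<le> sqrt M" "(sqrt M)\<^sup>2 = M" by simp_all
  then show ?thesis using M unfolding singular_values_def by (simp del: of_real_power)
qed

text \<open>The largest Rayleigh quotient \<open>M\<close> of the Gram matrix is an eigenvalue, so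
  \<open>sqrt M\<close> is one of the singular values and lies below their maximum.\<close>

lemma euclidean_norm_mult_le_sigma_max:
  assumes A: "A \<in> carrier_mat m n" and n: "0 < n" and x: "x \<in> carrier_vec n"
  shows "euclidean_norm (A *\<^sub>v x) \<le> sigma_max A * euclidean_norm x"
proof -
  have AA: "mat_adjoint A * A \<in> carrier_mat n n"
    using mult_carrier_mat[OF mat_adjoint_carrier[OF A] A] .
  obtain M where M: "eigenvalue (mat_adjoint A * A) (complex_of_real M)"
    and M_bound: "\<And>x. x \<in> carrier_vec n \<Longrightarrow>
      Re (x \<bullet>c ((mat_adjoint A * A) *\<^sub>v x)) \<le> M * (euclidean_norm x)\<^sup>2"
    using hermitian_max_eigenvalue[OF AA hermitian_gram[OF A] n] by blast
  have M0: "0 \<le> M" by (rule eigenvalue_gram_nonneg(1)[OF A M])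
  have "sqrt M \<le> sigma_max A"
    unfolding sigma_max_def using finite_singular_values[OF A] sqrt_in_singular_values[OF A M] by simp
  moreover have "(euclidean_norm (A *\<^sub>v x))\<^sup>2 \<le> M * (euclidean_norm x)\<^sup>2"
    using M_bound[OF x] by (simp only: quadratic_form_gram[OF A x] Re_complex_of_real)
  then have "euclidean_norm (A *\<^sub>v x) \<le> sqrt M * euclidean_norm x"
    using M0 by - (rule power2_le_imp_le, auto simp: power_mult_distrib)
  ultimately show ?thesis
    by (meson euclidean_norm_nonneg mult_right_mono order.trans)
qed

lemma sigma_min_mult_le_euclidean_norm:
  assumes A: "A \<in> carrier_mat m n" and n: "0 < n" and x: "x \<in> carrier_vec n"
  shows "sigma_min A * euclidean_norm x \<le> euclidean_norm (A *\<^sub>v x)"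
proof -
  have AA: "mat_adjoint A * A \<in> carrier_mat n n"
    using mult_carrier_mat[OF mat_adjoint_carrier[OF A] A] .
  obtain M where M: "eigenvalue (mat_adjoint A * A) (complex_of_real M)"
    and M_bound: "\<And>x. x \<in> carrier_vec n \<Longrightarrow>
      M * (euclidean_norm x)\<^sup>2 \<le> Re (x \<bullet>c ((mat_adjoint A * A) *\<^sub>v x))"
    using hermitian_min_eigenvalue[OF AA hermitian_gram[OF A] n] by blast
  have M0: "0 \<le> M" by (rule eigenvalue_gram_nonneg(1)[OF A M])
  have "sigma_min A \<le> sqrt M"
    unfolding sigma_min_def using finite_singular_values[OF A] sqrt_in_singular_values[OF A M] by simp
  moreover have "M * (euclidean_norm x)\<^sup>2 \<le> (euclidean_norm (A *\<^sub>v x))\<^sup>2"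
    using M_bound[OF x] by (simp only: quadratic_form_gram[OF A x] Re_complex_of_real)
  then have "sqrt M * euclidean_norm x \<le> euclidean_norm (A *\<^sub>v x)"
    using M0 by - (rule power2_le_imp_le, auto simp: power_mult_distrib)
  ultimately show ?thesis
    by (meson euclidean_norm_nonneg mult_right_mono order.trans)
qed

lemma singular_values_nonempty:
  assumes A: "A \<in> carrier_mat m n" and n: "0 < n"
  shows "singular_values A \<noteq> {}"
proof -
  obtain M where M: "eigenvalue (mat_adjoint A * A) (complex_of_real M)"
    using hermitian_max_eigenvalue[OF mult_carrier_mat[OF mat_adjoint_carrier[OF A] A]
        hermitian_gram[OF A] n] by blast
  then show ?thesis using sqrt_in_singular_values[OF A] by blast
qed

section \<open>Full column rank and the bounded left inverse\<close>

lemma full_column_rank_mult_eq_0: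
  assumes A: "A \<in> carrier_mat m n" and rank: "full_column_rank A"
    and x: "x \<in> carrier_vec n" and Ax: "A *\<^sub>v x = 0\<^sub>v m"
  shows "x = 0\<^sub>v n"
proof (rule ccontr)
  assume "x \<noteq> 0\<^sub>v n"
  interpret vec_space "TYPE(complex)" m .
  have rank_n: "rank A = n" using A rank by (simp add: full_column_rank_def)
  \<comment> \<open>Linear independence concerns the set of columns and would not notice a repeated
    column. Since rank \<open>n\<close> is the size of a maximal independent set of columns, there
    are at least \<open>n\<close> different ones.\<close>
  have "distinct (cols A)"
  proof -
    obtain S where S: "maximal S (\<lambda>T. T \<subseteq> set (cols A) \<and> lin_indpt T)"
      using maximal_exists[of "(\<lambda>T. T \<subseteq> set (cols A) \<and> lin_indpt T)" "card (set (cols A))" "{}"]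
      by (meson List.finite_set card_mono empty_iff empty_subsetI finite_lin_indpt2 rev_finite_subset)
    then have "n = card S" using rank_card_indpt[OF A S] rank_n by simp
    also have "\<dots> \<le> card (set (cols A))"
      using S by (intro card_mono) (auto simp: maximal_def)
    finally have "length (cols A) \<le> card (set (cols A))" using A by simp
    then show ?thesis using card_length[of "cols A"] card_distinct by (metis le_antisym)
  qed
  then show False
    using lin_depI[OF A x \<open>x \<noteq> 0\<^sub>v n\<close> Ax] full_rank_lin_indpt[OF A rank_n] by simp
qed

text \<open>The minimum is attained, so its square is itself an eigenvalue of the Gram matrix, which
  is positive because \<open>A\<close> is injective.\<close>

lemma sigma_min_pos:
  assumes A: "A \<in> carrier_mat m n" and n: "0 < n" and rank: "full_column_rank A"
  shows "0 < sigma_min A"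
proof -
  have "sigma_min A \<in> singular_values A"
    unfolding sigma_min_def
    by (rule Min_in[OF finite_singular_values[OF A] singular_values_nonempty[OF A n]])
  then have "0 \<le> sigma_min A"
    and "eigenvalue (mat_adjoint A * A) (complex_of_real ((sigma_min A)\<^sup>2))"
    by (simp_all only: singular_values_def mem_Collect_eq)
  then have "0 \<le> sigma_min A" "0 < (sigma_min A)\<^sup>2"
    using eigenvalue_gram_nonneg(2)[OF A _ full_column_rank_mult_eq_0[OF A rank]] by blast+
  then show ?thesis by simp
qed

lemma sigma_min_le_sigma_max:
  assumes A: "A \<in> carrier_mat m n" and n: "0 < n"
  shows "sigma_min A \<le> sigma_max A"
  unfolding sigma_min_def sigma_max_def
  using finite_singular_values[OF A] singular_values_nonempty[OF A n]
  by (meson Max_ge Min_in)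

text \<open>The witness is the Moore-Penrose inverse \<open>(A\<^sup>* A)\<^sup>-\<^sup>1 A\<^sup>*\<close>.\<close>

lemma full_column_rank_left_inverse:
  assumes A: "A \<in> carrier_mat m n" and n: "0 < n" and rank: "full_column_rank A"
  obtains B where "B \<in> carrier_mat n m" "B * A = 1\<^sub>m n"
    "\<And>y. y \<in> carrier_vec m \<Longrightarrow> euclidean_norm (B *\<^sub>v y) \<le> 1 / sigma_min A * euclidean_norm y"
proof -
  let ?S = "mat_adjoint A"
  define H where "H = ?S * A"
  have S: "?S \<in> carrier_mat n m" using A by simp
  have H: "H \<in> carrier_mat n n" unfolding H_def using mult_carrier_mat[OF S A] .
  have "det H \<noteq> 0"
  proof
    assume "det H = 0"
    then obtain v where v: "v \<in> carrier_vec n" "v \<noteq> 0\<^sub>v n" "H *\<^sub>v v = 0\<^sub>v n"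
      using det_0_iff_vec_prod_zero_field[OF H] by blast
    have "complex_of_real 0 \<cdot>\<^sub>v v = 0\<^sub>v n" using v(1) by auto
    then have "eigenvalue (?S * A) (complex_of_real 0)"
      using v H unfolding eigenvalue_def eigenvector_def H_def[symmetric]
      by (intro exI[of _ v]) simp
    then show False
      using eigenvalue_gram_nonneg(2)[OF A _ full_column_rank_mult_eq_0[OF A rank]] by blast
  qed
  then obtain L where L: "L \<in> carrier_mat n n" and LH: "L * H = 1\<^sub>m n" and HL: "H * L = 1\<^sub>m n"
    using det_non_zero_imp_unit[OF H] H unfolding Units_def by (auto simp: ring_mat_def)
  define B where "B = L * ?S"
  have B: "B \<in> carrier_mat n m" unfolding B_def using L S by simp
  have "B * A = 1\<^sub>m n"
    unfolding B_def using LH assoc_mult_mat[OF L S A] by (simp add: H_def)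
  moreover have "euclidean_norm (B *\<^sub>v y) \<le> 1 / sigma_min A * euclidean_norm y"
    if y: "y \<in> carrier_vec m" for y
  proof -
    define x where "x = B *\<^sub>v y"
    have x: "x \<in> carrier_vec n" using B y by (simp add: x_def)
    have Ax: "A *\<^sub>v x \<in> carrier_vec m" using A x by simp
    have Sy: "?S *\<^sub>v y \<in> carrier_vec n" using S y by (rule mult_mat_vec_carrier)
    \<comment> \<open>The normal equations of the least squares problem for \<open>y\<close>: the
      residual \<open>y - A *\<^sub>v x\<close> is annihilated by the adjoint of
      \<open>A\<close>.\<close>
    have "?S *\<^sub>v (A *\<^sub>v x) = H *\<^sub>v x"
      unfolding H_def using assoc_mult_mat_vec[OF S A x] by simp
    also have "\<dots> = H *\<^sub>v (L *\<^sub>v (?S *\<^sub>v y))"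
      unfolding x_def B_def using assoc_mult_mat_vec[OF L S y] by simp
    also have "\<dots> = ?S *\<^sub>v y"
      using assoc_mult_mat_vec[OF H L Sy] HL Sy by simp
    finally have normal_eq: "?S *\<^sub>v (A *\<^sub>v x) = ?S *\<^sub>v y" .
    \<comment> \<open>\<open>A x\<close> is the orthogonal projection of \<open>y\<close> to the range of \<open>A\<close>\<close>
    have "(A *\<^sub>v x) \<bullet>c y = (A *\<^sub>v x) \<bullet>c (A *\<^sub>v x)"
      using cscalar_prod_mult_mat_vec[OF A x y] cscalar_prod_mult_mat_vec[OF A x Ax] normal_eq
      by simp
    \<comment> \<open>Pythagoras: the cross term is twice the squared norm of
      \<open>A *\<^sub>v x\<close>, so projecting \<open>y\<close> does not lengthen it.\<close>
    then have "(euclidean_norm (A *\<^sub>v x - y))\<^sup>2 = (euclidean_norm y)\<^sup>2 - (euclidean_norm (A *\<^sub>v x))\<^sup>2"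
      unfolding euclidean_norm_sq_diff[OF Ax y] by (simp add: cscalar_prod_self)
    then have "(euclidean_norm (A *\<^sub>v x))\<^sup>2 \<le> (euclidean_norm y)\<^sup>2"
      by (metis diff_ge_0_iff_ge zero_le_power2)
    then have "euclidean_norm (A *\<^sub>v x) \<le> euclidean_norm y"
      by (rule power2_le_imp_le) simp
    then have "sigma_min A * euclidean_norm x \<le> euclidean_norm y"
      using sigma_min_mult_le_euclidean_norm[OF A n x] by simp
    then show ?thesis
      using sigma_min_pos[OF A n rank] by (simp add: x_def field_simps)
  qed
  ultimately show thesis using that B by blast
qed

section \<open>Entries of Tucker products\<close>

lemma multi_indices_cong:
  "(\<And>n. n < N \<Longrightarrow> d n = e n) \<Longrightarrow> multi_indices N d = multi_indices N e"
  unfolding multi_indices_def by (rule PiE_cong) auto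

lemma finite_multi_indices: "finite (multi_indices N d)"
  unfolding multi_indices_def by (rule finite_PiE) auto

lemma multi_indices_less: "i \<in> multi_indices N d \<Longrightarrow> n < N \<Longrightarrow> i n < d n"
  unfolding multi_indices_def by (auto simp: PiE_iff)

lemma tensors_eqI:
  assumes "X \<in> tensors N d" "Y \<in> tensors N d"
    and "\<And>i. i \<in> multi_indices N d \<Longrightarrow> X i = Y i"
  shows "X = Y"
  using assms unfolding tensors_def by (rule PiE_ext)

text \<open>Splitting off the last coordinate is the counterpart of one more mode product in
  \<open>tucker_upto\<close>.\<close>

lemma sum_PiE_Suc:
  fixes f :: "(nat \<Rightarrow> 'a) \<Rightarrow> 'b::comm_monoid_add"
  shows "(\<Sum>k\<in>PiE {..<Suc m} S. f k) = (\<Sum>a\<in>S m. \<Sum>k\<in>PiE {..<m} S. f (k(m := a)))"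
proof -
  have "PiE {..<Suc m} S = (\<lambda>(a, k). k(m := a)) ` (S m \<times> PiE {..<m} S)"
    unfolding lessThan_Suc by (rule PiE_insert_eq)
  then have "(\<Sum>k\<in>PiE {..<Suc m} S. f k) = (\<Sum>(a, k)\<in>S m \<times> PiE {..<m} S. f (k(m := a)))"
    using inj_combinator[of m "{..<m}" S] by (simp add: sum.reindex case_prod_unfold)
  then show ?thesis by (simp add: sum.cartesian_product)
qed

lemma tucker_upto_in_tensors:
  assumes "G \<in> tensors N J" "m \<le> N"
  shows "tucker_upto N J G F m \<in> tensors N (\<lambda>n. if n < m then dim_row (F n) else J n)"
proof (cases m)
  case 0
  then show ?thesis using assms by simp
next
  case (Suc l)
  have "(\<lambda>n. if n < l then dim_row (F n) else J n)(l := dim_row (F l))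
      = (\<lambda>n. if n < Suc l then dim_row (F n) else J n)"
    by (auto simp: fun_eq_iff)
  then show ?thesis by (simp add: Suc mode_product_def tensors_def)
qed

text \<open>After \<open>m\<close> steps the modes below \<open>m\<close> are contracted and the
  others are still free, so \<open>G\<close> is evaluated at an index mixed from \<open>k\<close>
  and \<open>i\<close>. The next step moves mode \<open>m\<close> from \<open>i\<close> to
  \<open>k\<close>.\<close>

lemma tucker_upto_eq_sum:
  assumes "m \<le> N" and "i \<in> multi_indices N (\<lambda>n. if n < m then dim_row (F n) else J n)"
  shows "tucker_upto N J G F m i = (\<Sum>k\<in>(\<Pi>\<^sub>E n\<in>{..<m}. {..<J n}).
           G (\<lambda>n. if n < m then k n else i n) * (\<Prod>n<m. F n $$ (i n, k n)))"
  using assms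
proof (induction m arbitrary: i)
  case 0
  then show ?case by simp
next
  case (Suc m)
  let ?d = "\<lambda>m n. if n < m then dim_row (F n) else J n"
  let ?g = "\<lambda>m i k. G (\<lambda>n. if n < m then k n else i n)"
  have d: "(?d m)(m := dim_row (F m)) = ?d (Suc m)" by (auto simp: fun_eq_iff)
  have "tucker_upto N J G F (Suc m) i
      = (\<Sum>a<J m. tucker_upto N J G F m (i(m := a)) * F m $$ (i m, a))"
    using Suc.prems by (simp add: mode_product_def d)
  also have "\<dots> = (\<Sum>a<J m. \<Sum>k\<in>(\<Pi>\<^sub>E n\<in>{..<m}. {..<J n}).
      ?g (Suc m) i (k(m := a)) * (\<Prod>n<Suc m. F n $$ (i n, (k(m := a)) n)))"
  proof (rule sum.cong[OF refl])
    fix a assume a: "a \<in> {..<J m}"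
    have "i(m := a) \<in> multi_indices N (?d m)"
      using Suc.prems a by (auto simp: multi_indices_def PiE_iff extensional_def less_Suc_eq split: if_splits)
    then have "tucker_upto N J G F m (i(m := a)) = (\<Sum>k\<in>(\<Pi>\<^sub>E n\<in>{..<m}. {..<J n}).
        ?g m (i(m := a)) k * (\<Prod>n<m. F n $$ ((i(m := a)) n, k n)))"
      using Suc by simp
    also have "\<dots> = (\<Sum>k\<in>(\<Pi>\<^sub>E n\<in>{..<m}. {..<J n}).
        ?g (Suc m) i (k(m := a)) * (\<Prod>n<m. F n $$ (i n, k n)))"
    proof (rule sum.cong[OF refl])
      \<comment> \<open>Whether \<open>a\<close> is stored in \<open>i\<close> or in
        \<open>k\<close>, the index passed to \<open>G\<close> is the same, and the product over the
        modes below \<open>m\<close> does not see coordinate \<open>m\<close>.\<close>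
      fix k
      have "(\<lambda>n. if n < m then k n else (i(m := a)) n) = (\<lambda>n. if n < Suc m then (k(m := a)) n else i n)"
        by (auto simp: fun_eq_iff less_Suc_eq)
      then show "?g m (i(m := a)) k * (\<Prod>n<m. F n $$ ((i(m := a)) n, k n))
          = ?g (Suc m) i (k(m := a)) * (\<Prod>n<m. F n $$ (i n, k n))"
        by simp
    qed
    finally show "tucker_upto N J G F m (i(m := a)) * F m $$ (i m, a)
        = (\<Sum>k\<in>(\<Pi>\<^sub>E n\<in>{..<m}. {..<J n}).
            ?g (Suc m) i (k(m := a)) * (\<Prod>n<Suc m. F n $$ (i n, (k(m := a)) n)))"
      by (simp add: sum_distrib_right mult.assoc)
  qed
  also have "\<dots> = (\<Sum>k\<in>(\<Pi>\<^sub>E n\<in>{..<Suc m}. {..<J n}).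
      ?g (Suc m) i k * (\<Prod>n<Suc m. F n $$ (i n, k n)))"
    by (simp only: sum_PiE_Suc)
  finally show ?case .
qed

lemma tucker_in_tensors:
  assumes "G \<in> tensors N J" "\<And>n. n < N \<Longrightarrow> F n \<in> carrier_mat (I n) (J n)"
  shows "tucker N J G F \<in> tensors N I"
proof -
  have "multi_indices N (\<lambda>n. if n < N then dim_row (F n) else J n) = multi_indices N I"
    using assms(2) by (intro multi_indices_cong) auto
  then show ?thesis
    using tucker_upto_in_tensors[OF assms(1) order.refl, of F] by (simp add: tucker_def tensors_def)
qed

lemma tucker_eq_sum:
  assumes F: "\<And>n. n < N \<Longrightarrow> F n \<in> carrier_mat (I n) (J n)" and i: "i \<in> multi_indices N I"
  shows "tucker N J G F i = (\<Sum>k\<in>multi_indices N J. G k * (\<Prod>n<N. F n $$ (i n, k n)))"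
proof -
  have "multi_indices N (\<lambda>n. if n < N then dim_row (F n) else J n) = multi_indices N I"
    using F by (intro multi_indices_cong) auto
  then have "tucker N J G F i = (\<Sum>k\<in>multi_indices N J.
      G (\<lambda>n. if n < N then k n else i n) * (\<Prod>n<N. F n $$ (i n, k n)))"
    unfolding tucker_def multi_indices_def[of N J] using i
    by (intro tucker_upto_eq_sum) auto
  also have "\<dots> = (\<Sum>k\<in>multi_indices N J. G k * (\<Prod>n<N. F n $$ (i n, k n)))"
  proof (rule sum.cong[OF refl])
    \<comment> \<open>From \<open>N\<close> on, both \<open>i\<close> and \<open>k\<close> are
      \<open>undefined\<close>, so the mixed index is exactly \<open>k\<close>.\<close>
    fix k assume "k \<in> multi_indices N J"
    then have "(\<lambda>n. if n < N then k n else i n) = k"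
      using i by (auto simp: fun_eq_iff multi_indices_def PiE_iff extensional_def)
    then show "G (\<lambda>n. if n < N then k n else i n) * (\<Prod>n<N. F n $$ (i n, k n))
        = G k * (\<Prod>n<N. F n $$ (i n, k n))" by simp
  qed
  finally show ?thesis .
qed

lemma sum_multi_indices_prod:
  fixes f :: "nat \<Rightarrow> nat \<Rightarrow> complex"
  shows "(\<Sum>k\<in>multi_indices N d. \<Prod>n<N. f n (k n)) = (\<Prod>n<N. \<Sum>a<d n. f n a)"
  unfolding multi_indices_def by (simp add: prod_sum_PiE)

text \<open>Each summand of the entry formula is now a product over the modes, so by distributivity
  the sum factors into the entries of the matrix-vector products.\<close>

lemma tucker_outer_product:
  assumes F: "\<And>n. n < N \<Longrightarrow> F n \<in> carrier_mat (I n) (J n)"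
    and x: "\<And>n. n < N \<Longrightarrow> x n \<in> carrier_vec (J n)"
  shows "tucker N J (outer_product N J x) F = outer_product N I (\<lambda>n. F n *\<^sub>v x n)"
proof (rule tensors_eqI[of _ N I])
  show "tucker N J (outer_product N J x) F \<in> tensors N I"
    by (rule tucker_in_tensors) (auto simp: outer_product_def tensors_def F)
  show "outer_product N I (\<lambda>n. F n *\<^sub>v x n) \<in> tensors N I"
    by (simp add: outer_product_def tensors_def)
  fix i assume i: "i \<in> multi_indices N I"
  have "tucker N J (outer_product N J x) F i
      = (\<Sum>k\<in>multi_indices N J. \<Prod>n<N. F n $$ (i n, k n) * x n $ k n)"
    by (simp add: tucker_eq_sum[OF F i] outer_product_def prod.distrib mult_ac cong: sum.cong)
  also have "\<dots> = (\<Prod>n<N. \<Sum>a<J n. F n $$ (i n, a) * x n $ a)"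
    by (rule sum_multi_indices_prod)
  also have "\<dots> = outer_product N I (\<lambda>n. F n *\<^sub>v x n) i"
  proof -
    have "(\<Sum>a<J n. F n $$ (i n, a) * x n $ a) = (F n *\<^sub>v x n) $ i n" if "n < N" for n
      using F[OF that] x[OF that] multi_indices_less[OF i that]
      by (auto simp: scalar_prod_def atLeast0LessThan intro!: sum.cong)
    then show ?thesis using i by (simp add: outer_product_def)
  qed
  finally show "tucker N J (outer_product N J x) F i
      = outer_product N I (\<lambda>n. F n *\<^sub>v x n) i" .
qed

text \<open>After exchanging the two sums, the weight of \<open>G k\<close> in entry
  \<open>j\<close> is the product over the modes of entries of \<open>B n * F n\<close>, which is a
  Kronecker delta.\<close>

lemma tucker_left_inverse:
  assumes G: "G \<in> tensors N J"
    and F: "\<And>n. n < N \<Longrightarrow> F n \<in> carrier_mat (I n) (J n)"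
    and B: "\<And>n. n < N \<Longrightarrow> B n \<in> carrier_mat (J n) (I n)"
    and BF: "\<And>n. n < N \<Longrightarrow> B n * F n = 1\<^sub>m (J n)"
  shows "tucker N I (tucker N J G F) B = G"
proof (rule tensors_eqI[of _ N J])
  show "tucker N I (tucker N J G F) B \<in> tensors N J"
    by (intro tucker_in_tensors[where J = I] tucker_in_tensors[where J = J]) (use assms in auto)
  show "G \<in> tensors N J" by (rule G)
  fix j assume j: "j \<in> multi_indices N J"
  have "tucker N I (tucker N J G F) B j
      = (\<Sum>i\<in>multi_indices N I. (\<Sum>k\<in>multi_indices N J. G k * (\<Prod>n<N. F n $$ (i n, k n)))
          * (\<Prod>n<N. B n $$ (j n, i n)))"
    by (simp add: tucker_eq_sum[OF B j] tucker_eq_sum[OF F])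
  also have "\<dots> = (\<Sum>k\<in>multi_indices N J. G k *
      (\<Sum>i\<in>multi_indices N I. \<Prod>n<N. B n $$ (j n, i n) * F n $$ (i n, k n)))"
    unfolding sum_distrib_right sum_distrib_left
    by (subst sum.swap) (simp add: prod.distrib mult_ac)
  also have "\<dots> = (\<Sum>k\<in>multi_indices N J. G k * (if k = j then 1 else 0))"
  proof (rule sum.cong[OF refl])
    fix k assume k: "k \<in> multi_indices N J"
    have "(\<Sum>i\<in>multi_indices N I. \<Prod>n<N. B n $$ (j n, i n) * F n $$ (i n, k n))
        = (\<Prod>n<N. \<Sum>a<I n. B n $$ (j n, a) * F n $$ (a, k n))"
      by (rule sum_multi_indices_prod)
    also have "\<dots> = (\<Prod>n<N. if j n = k n then 1 else 0)"
    proof (rule prod.cong[OF refl])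
      fix n assume "n \<in> {..<N}"
      then have n: "n < N" by simp
      note jk = multi_indices_less[OF j n] multi_indices_less[OF k n]
      have "(\<Sum>a<I n. B n $$ (j n, a) * F n $$ (a, k n)) = (B n * F n) $$ (j n, k n)"
        using jk F[OF n] B[OF n] by (simp add: scalar_prod_def atLeast0LessThan)
      then show "(\<Sum>a<I n. B n $$ (j n, a) * F n $$ (a, k n)) = (if j n = k n then 1 else 0)"
        using jk by (simp add: BF[OF n])
    qed
    also have "\<dots> = (if k = j then 1 else 0)"
    proof (cases "k = j")
      \<comment> \<open>Both indices are \<open>undefined\<close> from \<open>N\<close> on, so they
        differ in some mode below \<open>N\<close>, and the factor of that mode vanishes.\<close>
      case False
      then obtain n where "n < N" "k n \<noteq> j n"
        using j k unfolding multi_indices_def by (metis PiE_ext lessThan_iff)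
      then show ?thesis using False by (auto intro!: prod_zero)
    qed simp
    finally show "G k * (\<Sum>i\<in>multi_indices N I. \<Prod>n<N. B n $$ (j n, i n) * F n $$ (i n, k n))
        = G k * (if k = j then 1 else 0)" by simp
  qed
  also have "\<dots> = G j"
    using j by (simp add: finite_multi_indices if_distrib[of "(*) _"] cong: if_cong)
  finally show "tucker N I (tucker N J G F) B j = G j" .
qed

section \<open>Unit decompositions and their transport by matrices\<close>

text \<open>This keeps the set under the infimum nonempty. The enumeration \<open>h\<close> turns
  the multi-indices into the numbered terms that \<open>unit_decomposition\<close> asks for.\<close>

lemma unit_decomposition_exists:
  assumes X: "X \<in> tensors N d"
  obtains r c x where "unit_decomposition N d X r c x"
proof -
  obtain h where h: "bij_betw h {..<card (multi_indices N d)} (multi_indices N d)"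
    using ex_bij_betw_nat_finite[OF finite_multi_indices[of N d]] by (auto simp: atLeast0LessThan)
  define x where "x s n = (unit_vec (d n) (h s n) :: complex vec)" for s n
  let ?S = "\<lambda>i. \<Sum>s<card (multi_indices N d). X (h s) * outer_product N d (x s) i"
  have "X = restrict ?S (multi_indices N d)"
  proof (rule tensors_eqI[OF X])
    show "restrict ?S (multi_indices N d) \<in> tensors N d"
      by (simp add: tensors_def)
    fix i assume i: "i \<in> multi_indices N d"
    have "?S i = (\<Sum>k\<in>multi_indices N d. X k * (\<Prod>n<N. unit_vec (d n) (k n) $ i n))"
      using sum.reindex_bij_betw[OF h, of "\<lambda>k. X k * (\<Prod>n<N. unit_vec (d n) (k n) $ i n)"] i
      by (simp add: outer_product_def x_def)
    also have "\<dots> = (\<Sum>k\<in>multi_indices N d. if k = i then X i else 0)"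
    proof (rule sum.cong[OF refl])
      fix k assume k: "k \<in> multi_indices N d"
      show "X k * (\<Prod>n<N. unit_vec (d n) (k n) $ i n) = (if k = i then X i else 0)"
      proof (cases "k = i")
        case True
        then show ?thesis using multi_indices_less[OF i] by simp
      next
        case False
        then obtain n where n: "n < N" "k n \<noteq> i n"
          using i k unfolding multi_indices_def by (metis PiE_ext lessThan_iff)
        then have "unit_vec (d n) (k n) $ i n = (0 :: complex)"
          using multi_indices_less[OF i n(1)] multi_indices_less[OF k n(1)] by simp
        then have "(\<Prod>n<N. unit_vec (d n) (k n) $ i n) = (0 :: complex)"
          using n(1) by (intro prod_zero) auto
        then show ?thesis using False by simp
      qed
    qed
    also have "\<dots> = X i" using i by (simp add: finite_multi_indices)
    finally show "X i = restrict ?S (multi_indices N d) i" using i by simp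
  qed
  moreover have "x s n \<in> carrier_vec (d n) \<and> euclidean_norm (x s n) = 1"
    if "s < card (multi_indices N d)" "n < N" for s n
    using bij_betwE[OF h] multi_indices_less[of "h s" N d n] that
    by (auto simp: x_def euclidean_norm_unit_vec)
  ultimately have "unit_decomposition N d X (card (multi_indices N d)) (\<lambda>s. X (h s)) x"
    unfolding unit_decomposition_def by (intro conjI) simp_all
  then show thesis by (rule that)
qed

text \<open>Each image vector is split into its length and a unit direction, and the lengths are
  absorbed into the coefficient. The number \<open>r\<close> of terms is kept, so coefficients can
  be compared term by term.\<close>

lemma unit_decomposition_tucker:
  assumes F: "\<And>n. n < N \<Longrightarrow> F n \<in> carrier_mat (I n) (J n)"
    and I: "\<And>n. n < N \<Longrightarrow> 0 < I n"
    and bound: "\<And>n v. n < N \<Longrightarrow> v \<in> carrier_vec (J n) \<Longrightarrow>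
      euclidean_norm (F n *\<^sub>v v) \<le> b n * euclidean_norm v"
    and dec: "unit_decomposition N J G r c x"
  shows "\<exists>c' x'. unit_decomposition N I (tucker N J G F) r c' x' \<and>
    (\<forall>s<r. cmod (c' s) \<le> (\<Prod>n<N. b n) * cmod (c s))"
proof -
  define a where "a s n = euclidean_norm (F n *\<^sub>v x s n)" for s n
  \<comment> \<open>If the image is zero, any unit vector will do, since the length 0 removes its
    contribution; \<open>unit_vec (I n) 0\<close> is one because \<open>0 < I n\<close>.\<close>
  define x' where "x' s n = (if a s n = 0 then unit_vec (I n) 0
    else complex_of_real (1 / a s n) \<cdot>\<^sub>v (F n *\<^sub>v x s n))" for s n
  define c' where "c' s = c s * (\<Prod>n<N. complex_of_real (a s n))" for s
  have x: "x s n \<in> carrier_vec (J n)" "euclidean_norm (x s n) = 1" if "s < r" "n < N" for s n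
    using dec that unfolding unit_decomposition_def by auto
  have Fx: "F n *\<^sub>v x s n \<in> carrier_vec (I n)" if "s < r" "n < N" for s n
    using F[OF that(2)] x(1)[OF that] by simp
  have a_x': "complex_of_real (a s n) \<cdot>\<^sub>v x' s n = F n *\<^sub>v x s n" if "s < r" "n < N" for s n
  proof (cases "a s n = 0")
    case True
    then have "F n *\<^sub>v x s n = 0\<^sub>v (I n)"
      using euclidean_norm_eq_0_iff[OF Fx[OF that]] by (simp add: a_def)
    then show ?thesis using True by (auto simp: x'_def)
  next
    case False
    then show ?thesis by (simp add: x'_def smult_smult_assoc)
  qed
  have outer: "outer_product N I (\<lambda>n. F n *\<^sub>v x s n) i
      = (\<Prod>n<N. complex_of_real (a s n)) * outer_product N I (x' s) i"
    if s: "s < r" and i: "i \<in> multi_indices N I" for s i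
  proof -
    have "(F n *\<^sub>v x s n) $ i n = complex_of_real (a s n) * x' s n $ i n" if n: "n < N" for n
    proof -
      have "x' s n \<in> carrier_vec (I n)" using Fx[OF s n] by (simp add: x'_def)
      then show ?thesis
        using multi_indices_less[OF i n] by (simp flip: a_x'[OF s n])
    qed
    then show ?thesis using i by (simp add: outer_product_def prod.distrib)
  qed
  have "tucker N J G F = (\<lambda>i\<in>multi_indices N I. \<Sum>s<r. c' s * outer_product N I (x' s) i)"
  proof (rule tensors_eqI[of _ N I])
    have "G \<in> tensors N J"
      using dec by (auto simp: unit_decomposition_def tensors_def)
    then show "tucker N J G F \<in> tensors N I"
      by (rule tucker_in_tensors) (rule F)
    show "(\<lambda>i\<in>multi_indices N I. \<Sum>s<r. c' s * outer_product N I (x' s) i) \<in> tensors N I"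
      by (simp add: tensors_def)
    fix i assume i: "i \<in> multi_indices N I"
    \<comment> \<open>Linearity of \<open>tucker\<close> in its core, read off from the entry
      formula, reduces the claim to rank-one terms.\<close>
    have "tucker N J G F i = (\<Sum>k\<in>multi_indices N J.
        (\<Sum>s<r. c s * outer_product N J (x s) k) * (\<Prod>n<N. F n $$ (i n, k n)))"
      using dec by (simp add: tucker_eq_sum[OF F i] unit_decomposition_def cong: sum.cong)
    also have "\<dots> = (\<Sum>s<r. c s * (\<Sum>k\<in>multi_indices N J.
        outer_product N J (x s) k * (\<Prod>n<N. F n $$ (i n, k n))))"
      unfolding sum_distrib_right sum_distrib_left mult.assoc by (rule sum.swap)
    also have "\<dots> = (\<Sum>s<r. c s * tucker N J (outer_product N J (x s)) F i)"
      by (simp add: tucker_eq_sum[OF F i])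
    also have "\<dots> = (\<Sum>s<r. c' s * outer_product N I (x' s) i)"
    proof (rule sum.cong[OF refl])
      fix s assume "s \<in> {..<r}"
      then have s: "s < r" by simp
      have "tucker N J (outer_product N J (x s)) F = outer_product N I (\<lambda>n. F n *\<^sub>v x s n)"
        by (rule tucker_outer_product) (use F x s in auto)
      then show "c s * tucker N J (outer_product N J (x s)) F i = c' s * outer_product N I (x' s) i"
        using outer[OF s i] by (simp add: c'_def)
    qed
    finally show "tucker N J G F i
        = (\<lambda>i\<in>multi_indices N I. \<Sum>s<r. c' s * outer_product N I (x' s) i) i"
      using i by simp
  qed
  moreover have "x' s n \<in> carrier_vec (I n) \<and> euclidean_norm (x' s n) = 1"
    if "s < r" "n < N" for s n
  proof (cases "a s n = 0")
    case True
    then show ?thesis using I[OF that(2)] by (simp add: x'_def euclidean_norm_unit_vec)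
  next
    case False
    moreover have "0 \<le> a s n" by (simp add: a_def)
    ultimately show ?thesis using Fx[OF that]
      by (simp add: x'_def euclidean_norm_smult norm_divide flip: a_def)
  qed
  ultimately have "unit_decomposition N I (tucker N J G F) r c' x'"
    unfolding unit_decomposition_def by blast
  moreover have "cmod (c' s) \<le> (\<Prod>n<N. b n) * cmod (c s)" if s: "s < r" for s
  proof -
    have "(\<Prod>n<N. a s n) \<le> (\<Prod>n<N. b n)"
      using bound[OF _ x(1)[OF s]] x(2)[OF s] by (intro prod_mono) (auto simp: a_def)
    moreover have "cmod (c' s) = (\<Prod>n<N. a s n) * cmod (c s)"
      by (simp add: c'_def a_def norm_mult flip: prod_norm)
    ultimately show ?thesis by (simp add: mult_right_mono)
  qed
  ultimately show ?thesis by blast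
qed

section \<open>Bounds for the quasi norm\<close>

lemma tensor_quasi_norm_le:
  assumes "unit_decomposition N d X r c x"
  shows "tensor_quasi_norm N d p X \<le> (\<Sum>s<r. cmod (c s) powr p) powr (1 / p)"
  unfolding tensor_quasi_norm_def
  using assms by (intro cInf_lower bdd_belowI[of _ 0]) auto

lemma tensor_quasi_norm_tucker_le:
  assumes p: "0 < p" and G: "G \<in> tensors N J"
    and F: "\<And>n. n < N \<Longrightarrow> F n \<in> carrier_mat (I n) (J n)"
    and I: "\<And>n. n < N \<Longrightarrow> 0 < I n"
    and b: "\<And>n. n < N \<Longrightarrow> 0 < b n"
    and bound: "\<And>n v. n < N \<Longrightarrow> v \<in> carrier_vec (J n) \<Longrightarrow>
      euclidean_norm (F n *\<^sub>v v) \<le> b n * euclidean_norm v"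
  shows "tensor_quasi_norm N I p (tucker N J G F) \<le> (\<Prod>n<N. b n) * tensor_quasi_norm N J p G"
proof -
  define \<beta> where "\<beta> = (\<Prod>n<N. b n)"
  have \<beta>: "0 < \<beta>" unfolding \<beta>_def using b by (intro prod_pos) auto
  \<comment> \<open>Dividing by \<beta> leaves the infimum for \<open>G\<close> alone on the right,
    so it suffices to bound each of its members from below.\<close>
  have "tensor_quasi_norm N I p (tucker N J G F) / \<beta> \<le> tensor_quasi_norm N J p G"
    unfolding tensor_quasi_norm_def[of N J p G]
  proof (rule cInf_greatest)
    show "{(\<Sum>s<r. cmod (c s) powr p) powr (1 / p) | r c x. unit_decomposition N J G r c x} \<noteq> {}"
    proof -
      obtain r c x where "unit_decomposition N J G r c x"
        by (rule unit_decomposition_exists[OF G])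
      then show ?thesis by auto
    qed
    fix z
    assume "z \<in> {(\<Sum>s<r. cmod (c s) powr p) powr (1 / p) | r c x. unit_decomposition N J G r c x}"
    then obtain r c x where z: "z = (\<Sum>s<r. cmod (c s) powr p) powr (1 / p)"
      and dec: "unit_decomposition N J G r c x" by blast
    have "\<exists>c' x'. unit_decomposition N I (tucker N J G F) r c' x' \<and>
        (\<forall>s<r. cmod (c' s) \<le> \<beta> * cmod (c s))"
      unfolding \<beta>_def by (rule unit_decomposition_tucker, fact F, fact I, fact bound, fact dec)
    then obtain c' x' where dec': "unit_decomposition N I (tucker N J G F) r c' x'"
      and c': "\<And>s. s < r \<Longrightarrow> cmod (c' s) \<le> \<beta> * cmod (c s)"
      by blast
    have "(\<Sum>s<r. cmod (c' s) powr p) \<le> (\<Sum>s<r. (\<beta> * cmod (c s)) powr p)"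
      using p c' by (intro sum_mono powr_mono2) auto
    also have "\<dots> = \<beta> powr p * (\<Sum>s<r. cmod (c s) powr p)"
      using \<beta> by (simp add: powr_mult sum_distrib_left)
    finally have "(\<Sum>s<r. cmod (c' s) powr p) powr (1 / p)
        \<le> (\<beta> powr p * (\<Sum>s<r. cmod (c s) powr p)) powr (1 / p)"
      using p by (intro powr_mono2) (auto intro: sum_nonneg)
    \<comment> \<open>The factor \<open>\<beta> powr p\<close> leaves the outer power as \<beta>
      because \<open>p * (1 / p) = 1\<close>.\<close>
    also have "\<dots> = \<beta> * z"
      using p \<beta> by (simp add: z powr_mult powr_powr sum_nonneg)
    finally show "tensor_quasi_norm N I p (tucker N J G F) / \<beta> \<le> z"
      using tensor_quasi_norm_le[OF dec', of p] \<beta> by (simp add: field_simps)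
  qed
  then show ?thesis using \<beta> by (simp add: \<beta>_def field_simps)
qed

theorem theorem9:
  fixes p :: real and N :: nat and I J :: "nat \<Rightarrow> nat"
    and X G :: tensor and F :: "nat \<Rightarrow> complex mat"
  assumes "0 < p" and "p \<le> 1"
    and "1 \<le> N"
    and "\<forall>n<N. 1 \<le> I n" and "\<forall>n<N. 1 \<le> J n"
    and "independent_tucker N I J X G F"
  shows "let \<beta> = (\<Prod>n<N. spectral_norm (F n));
             \<alpha> = \<beta> / (\<Prod>n<N. condition_number (F n))
         in \<alpha> * tensor_quasi_norm N J p G \<le> tensor_quasi_norm N I p X \<and>
            tensor_quasi_norm N I p X \<le> \<beta> * tensor_quasi_norm N J p G"
proof -
  have X: "X \<in> tensors N I" "X = tucker N J G F" and G: "G \<in> tensors N J"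
    and F: "\<And>n. n < N \<Longrightarrow> F n \<in> carrier_mat (I n) (J n)"
    and rank: "\<And>n. n < N \<Longrightarrow> full_column_rank (F n)"
    using assms(6) unfolding independent_tucker_def by auto
  have I: "\<And>n. n < N \<Longrightarrow> 0 < I n" and J: "\<And>n. n < N \<Longrightarrow> 0 < J n"
    using assms(4,5) by (auto simp: Suc_le_eq)
  have smin: "0 < sigma_min (F n)" if "n < N" for n
    using sigma_min_pos[OF F J rank] that by blast
  have smax: "0 < sigma_max (F n)" if "n < N" for n
    using sigma_min_le_sigma_max[OF F J, of n] smin[OF that] that by simp
  have upper: "tensor_quasi_norm N I p X \<le> (\<Prod>n<N. spectral_norm (F n)) * tensor_quasi_norm N J p G"
    unfolding X(2) spectral_norm_def
    by (rule tensor_quasi_norm_tucker_le[OF assms(1) G])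
      (auto intro: F I smax euclidean_norm_mult_le_sigma_max[OF F J])
  have "\<forall>n. \<exists>B. n < N \<longrightarrow> B \<in> carrier_mat (J n) (I n) \<and> B * F n = 1\<^sub>m (J n) \<and>
      (\<forall>y\<in>carrier_vec (I n). euclidean_norm (B *\<^sub>v y) \<le> 1 / sigma_min (F n) * euclidean_norm y)"
    by (metis full_column_rank_left_inverse[OF F J rank])
  then obtain B where B: "\<And>n. n < N \<Longrightarrow> B n \<in> carrier_mat (J n) (I n)"
    and BF: "\<And>n. n < N \<Longrightarrow> B n * F n = 1\<^sub>m (J n)"
    and B_bound: "\<And>n y. n < N \<Longrightarrow> y \<in> carrier_vec (I n) \<Longrightarrow>
      euclidean_norm (B n *\<^sub>v y) \<le> 1 / sigma_min (F n) * euclidean_norm y"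
    by metis
  have "tucker N I X B = G"
    unfolding X(2) by (rule tucker_left_inverse[OF G F B BF])
  \<comment> \<open>The same estimate with the shapes exchanged: the target shape is now
    \<open>J\<close>, so \<open>0 < J n\<close> provides the unit vectors for vanishing
    images.\<close>
  then have "tensor_quasi_norm N J p G \<le> (\<Prod>n<N. 1 / sigma_min (F n)) * tensor_quasi_norm N I p X"
    using tensor_quasi_norm_tucker_le[OF assms(1) X(1) B J _ B_bound] smin by force
  moreover have "0 < (\<Prod>n<N. sigma_min (F n))"
    using smin by (intro prod_pos) auto
  ultimately have "(\<Prod>n<N. sigma_min (F n)) * tensor_quasi_norm N J p G \<le> tensor_quasi_norm N I p X"
    by (simp add: prod_dividef field_simps)
  moreover have "(\<Prod>n<N. spectral_norm (F n)) / (\<Prod>n<N. condition_number (F n)) = (\<Prod>n<N. sigma_min (F n))"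
    unfolding prod_dividef[symmetric]
    using smin[THEN less_imp_neq] smax[THEN less_imp_neq]
    by (intro prod.cong) (auto simp: spectral_norm_def condition_number_def)
  ultimately show ?thesis using upper by (simp add: Let_def del: times_divide_eq_left)
qed

end
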